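(* Let $n,m\ge 1$, let $a$ be an $n\times m$ array, and let $P=\{(x,y,z)\in\mathbb Z^3: 0\le x\le n,\ 0\le y\le z\le m\}$. Let $F:P\to\mathbb R$ be the unique function such that $F(x,y,z)=0$ whenever $x=0$ or $y=0$; $F(i,j,j)=f_a(i,j)$ for all $0\le i\le n$, $0\le j\le m$; and for every $w=(x,y,z)\in P$ with $x\ge1$, $y\ge1$, $y<z$, writing $v=w-(1,0,1)$, $$F(w)=\max\big(F(v+(1,0,0))+F(v+(0,0,1)),\ F(v+(0,-1,0))+F(v+(1,1,1))\big)-F(v)$$ (octahedron recurrence with propagation vector $(1,0,1)$). Then $F(i,j,m)=f_{\mathbf D a}(i,j)$ for all $0\le i\le n$, $0\le j\le m$, and $F(n,j,k)=f_{\mathbf L a}(j,k)$ for all $0\le j\le k\le m$.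
   Context: An $n\times m$ array is a function $a:\{1,\dots,n\}\times\{1,\dots,m\}\to\mathbb R_{\ge0}$ ($a(i,j)$ is the mass in column $i$, row $j$). For an array $a$ put $f_a(i,j)=\sum_{i'\le i,\ j'\le j}a(i',j')$ for all integers $i,j\ge 0$. For $1\le j\le m-1$, the operator $\mathbf D_j$ moves mass from row $j+1$ to row $j$: set $p_k=\sum_{i'\le k}a(i',j+1)-\sum_{i'<k}a(i',j)$ for $k=1,\dots,n$; then $\mathbf D_j a$ agrees with $a$ outside rows $j,j+1$, has the same column sums $(\mathbf D_ja)(i,j)+(\mathbf D_ja)(i,j+1)=a(i,j)+a(i,j+1)$, and $\sum_{i'\le i}(\mathbf D_ja)(i',j)=\sum_{i'\le i}a(i',j)+\max(p_1,\dots,p_i)$ for $i=1,\dots,n$. An array is $\mathbf D$-tight if $\mathbf D_j a=a$ for all $j$, equivalently $f_a(i-1,j)+f_a(i,j)-f_a(i-1,j-1)-f_a(i,j+1)\ge 0$ for all $1\le i\le n$, $1\le j\le m-1$. $\mathbf D a$ denotes the $\mathbf D$-tight array obtained from $a$ by applying the operators $\mathbf D_j$ repeatedly until a $\mathbf D$-tight array is reached (it is known that this array exists and is uniquely determined by $a$). With the transpose $a^T(j,i)=a(i,j)$ (an $m\times n$ array), put $\mathbf L a=(\mathbf D(a^T))^T$ (mass condensed to the left along rows). *)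

theory Defs
  imports Complex_Main "HOL-Library.Product_Plus"
begin

text \<open>
  An \<open>n \<times> m\<close> array is a total function \<open>nat \<Rightarrow> nat \<Rightarrow> real\<close>, column index first, indices starting
  from 1. It is required to vanish outside \<open>{1..n} \<times> {1..m}\<close>, so that equality of arrays is equality
  of functions and \<open>cumul a i j\<close> makes sense for all \<open>i\<close>, \<open>j\<close>.
\<close>

type_synonym arr = "nat \<Rightarrow> nat \<Rightarrow> real"

definition is_array :: "nat \<Rightarrow> nat \<Rightarrow> arr \<Rightarrow> bool" where
  "is_array n m a \<longleftrightarrow>
     (\<forall>i\<in>{1..n}. \<forall>j\<in>{1..m}. 0 \<le> a i j) \<and>
     (\<forall>i j. \<not> (i \<in> {1..n} \<and> j \<in> {1..m}) \<longrightarrow> a i j = 0)"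

definition cumul :: "arr \<Rightarrow> nat \<Rightarrow> nat \<Rightarrow> real" where
  "cumul a i j = (\<Sum>i'=1..i. \<Sum>j'=1..j. a i' j')"

definition excess :: "arr \<Rightarrow> nat \<Rightarrow> nat \<Rightarrow> real" where
  "excess a j k = (\<Sum>i'=1..k. a i' (j + 1)) - (\<Sum>i'=1..<k. a i' j)"

text \<open>
  \<open>moved a j i\<close> is the total mass that the operator of index \<open>j\<close> brings down from row \<open>j + 1\<close> to
  row \<open>j\<close> in the columns \<open>1, \<dots>, i\<close>; the mass brought down in column \<open>i\<close> alone is its increment.
\<close>

definition moved :: "arr \<Rightarrow> nat \<Rightarrow> nat \<Rightarrow> real" where
  "moved a j i = (if i = 0 then 0 else Max (excess a j ` {1..i}))"

definition D_op :: "nat \<Rightarrow> nat \<Rightarrow> arr \<Rightarrow> arr" where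
  "D_op n j a = (\<lambda>i r.
     if i \<in> {1..n} \<and> r = j then a i r + (moved a j i - moved a j (i - 1))
     else if i \<in> {1..n} \<and> r = j + 1 then a i r - (moved a j i - moved a j (i - 1))
     else a i r)"

definition D_tight :: "nat \<Rightarrow> nat \<Rightarrow> arr \<Rightarrow> bool" where
  "D_tight n m a \<longleftrightarrow> (\<forall>j\<in>{1..<m}. D_op n j a = a)"

inductive D_reach :: "nat \<Rightarrow> nat \<Rightarrow> arr \<Rightarrow> arr \<Rightarrow> bool" for n m :: nat and a :: arr where
  refl: "D_reach n m a a"
| step: "D_reach n m a b \<Longrightarrow> j \<in> {1..<m} \<Longrightarrow> D_reach n m a (D_op n j b)"

definition D_condense :: "nat \<Rightarrow> nat \<Rightarrow> arr \<Rightarrow> arr" where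
  "D_condense n m a = (THE b. D_reach n m a b \<and> D_tight n m b)"

definition arr_transpose :: "arr \<Rightarrow> arr" where
  "arr_transpose a = (\<lambda>j i. a i j)"

definition L_condense :: "nat \<Rightarrow> nat \<Rightarrow> arr \<Rightarrow> arr" where
  "L_condense n m a = arr_transpose (D_condense m n (arr_transpose a))"

definition prism :: "nat \<Rightarrow> nat \<Rightarrow> (int \<times> int \<times> int) set" where
  "prism n m = {(x, y, z). 0 \<le> x \<and> x \<le> int n \<and> 0 \<le> y \<and> y \<le> z \<and> z \<le> int m}"

text \<open>Only the values of \<open>F\<close> on \<open>prism n m\<close> are constrained.\<close>

definition octahedron_solution ::
  "nat \<Rightarrow> nat \<Rightarrow> arr \<Rightarrow> (int \<times> int \<times> int \<Rightarrow> real) \<Rightarrow> bool" where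
  "octahedron_solution n m a F \<longleftrightarrow>
     (\<forall>(x, y, z)\<in>prism n m. x = 0 \<or> y = 0 \<longrightarrow> F (x, y, z) = 0) \<and>
     (\<forall>i\<le>n. \<forall>j\<le>m. F (int i, int j, int j) = cumul a i j) \<and>
     (\<forall>(x, y, z)\<in>prism n m. 1 \<le> x \<and> 1 \<le> y \<and> y < z \<longrightarrow>
        (let v = (x, y, z) - (1, 0, 1) in
           F (x, y, z) = max (F (v + (1, 0, 0)) + F (v + (0, 0, 1)))
                             (F (v + (0, -1, 0)) + F (v + (1, 1, 1))) - F v))"


lemma D_op_other_rows: "r \<noteq> j \<Longrightarrow> r \<noteq> j + 1 \<Longrightarrow> D_op n j a i r = a i r"
  by (simp add: D_op_def)

lemma D_op_column_sum: "D_op n j a i j + D_op n j a i (j + 1) = a i j + a i (j + 1)"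
  by (simp add: D_op_def)

lemma D_op_prefix_sum:
  assumes "i \<le> n"
  shows "(\<Sum>i'=1..i. D_op n j a i' j) = (\<Sum>i'=1..i. a i' j) + moved a j i"
  using assms
proof (induction i)
  case 0
  then show ?case by (simp add: moved_def)
next
  case (Suc i)
  then show ?case by (simp add: D_op_def)
qed

function oct_rec :: "arr \<Rightarrow> nat \<Rightarrow> nat \<Rightarrow> nat \<Rightarrow> real" where
  "oct_rec a x y z =
     (if x = 0 \<or> y = 0 then 0
      else if z \<le> y then cumul a x y
      else max (oct_rec a x y (z - 1) + oct_rec a (x - 1) y z)
               (oct_rec a (x - 1) (y - 1) (z - 1) + oct_rec a x (y + 1) z)
           - oct_rec a (x - 1) y (z - 1))"
  by pat_completeness auto
termination
  by (relation "measures [\<lambda>(a, x, y, z). x, \<lambda>(a, x, y, z). z, \<lambda>(a, x, y, z). z - y]") auto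

declare oct_rec.simps [simp del]

lemma oct_rec_zero: "x = 0 \<or> y = 0 \<Longrightarrow> oct_rec a x y z = 0"
  by (subst oct_rec.simps) simp

lemma oct_rec_diag: "oct_rec a x y y = cumul a x y"
  by (subst oct_rec.simps) (auto simp: cumul_def)

lemma octahedron_solution_eq_oct_rec:
  assumes F: "octahedron_solution n m a F" and "x \<le> n" "y \<le> z" "z \<le> m"
  shows "F (int x, int y, int z) = oct_rec a x y z"
proof -
  have "x \<le> n \<Longrightarrow> y \<le> z \<Longrightarrow> z \<le> m \<Longrightarrow> octahedron_solution n m a F \<Longrightarrow> ?thesis"
  proof (induction a x y z rule: oct_rec.induct)
    case (1 a x y z)
    have P: "(int x, int y, int z) \<in> prism n m"
      using 1 by (simp add: prism_def)
    consider (zero) "x = 0 \<or> y = 0" | (diag) "x \<noteq> 0" "y \<noteq> 0" "y = z"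
      | (inner) "x \<noteq> 0" "y \<noteq> 0" "y < z"
      using "1.prems" by linarith
    then show ?case
    proof cases
      case zero
      then show ?thesis
        using P "1.prems"(4) by (auto simp: octahedron_solution_def oct_rec_zero)
    next
      case diag
      then show ?thesis
        using "1.prems" by (auto simp: octahedron_solution_def oct_rec_diag)
    next
      case inner
      then obtain x' z' where eqs: "x = Suc x'" "z = Suc z'"
        by (metis gr0_implies_Suc not_gr0 not_less0)
      obtain y' where y': "y = Suc y'"
        using inner by (metis not0_implies_Suc)
      have ineqs: "x' \<le> n" "y \<le> z'" "y' \<le> z'" "z' \<le> m" "y + 1 \<le> z"
        using inner eqs y' "1.prems" by auto
      have *: "F (int x, int y, int z) =
          max (F (int x, int y, int z') + F (int x', int y, int z))
              (F (int x', int y', int z') + F (int x, int (y + 1), int z)) - F (int x', int y, int z')"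
        using P "1.prems"(4) inner eqs y'
        by (force simp: octahedron_solution_def Let_def add.commute dest!: bspec[OF _ P])
      show ?thesis
        unfolding * oct_rec.simps[of a x y z]
        using "1.IH" "1.prems" inner ineqs eqs y' by simp
    qed
  qed
  then show ?thesis using assms by blast
qed

lemma octahedron_solution_exists: "\<exists>F. octahedron_solution n m a F"
proof -
  define F where "F = (\<lambda>(x, y, z). oct_rec a (nat x) (nat y) (nat z))"
  have "F (x, y, z) = 0" if "x = 0 \<or> y = 0" for x y z
    using that by (auto simp: F_def oct_rec_zero)
  moreover have "F (int i, int j, int j) = cumul a i j" for i j
    by (simp add: F_def oct_rec_diag)
  moreover have "F (x, y, z) = max (F (x, y, z - 1) + F (x - 1, y, z))
                     (F (x - 1, y - 1, z - 1) + F (x, y + 1, z)) - F (x - 1, y, z - 1)"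
    if "1 \<le> x" "1 \<le> y" "y < z" for x y z
  proof -
    have "nat (x - 1) = nat x - 1" "nat (y - 1) = nat y - 1" "nat (z - 1) = nat z - 1"
      "nat (y + 1) = nat y + 1" "nat x \<noteq> 0" "nat y \<noteq> 0" "\<not> nat z \<le> nat y"
      using that by auto
    then show ?thesis
      unfolding F_def using oct_rec.simps[of a "nat x" "nat y" "nat z"] by simp
  qed
  ultimately have "octahedron_solution n m a F"
    by (auto simp: octahedron_solution_def Let_def)
  then show ?thesis by blast
qed

lemma octahedron_solution_unique:
  assumes "octahedron_solution n m a F" "octahedron_solution n m a G" "w \<in> prism n m"
  shows "F w = G w"
proof -
  obtain x y z where w: "w = (x, y, z)" by (cases w)
  then have "w = (int (nat x), int (nat y), int (nat z))"
    and "nat x \<le> n" "nat y \<le> nat z" "nat z \<le> m"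
    using assms(3) by (auto simp: prism_def)
  then show ?thesis
    using octahedron_solution_eq_oct_rec[OF assms(1)] octahedron_solution_eq_oct_rec[OF assms(2)]
    by metis
qed

end

theory Submission
  imports Defs
begin

text \<open>
  The operators \<open>D_j\<close> are idempotent and satisfy the braid relations, so the word
  \<open>D_1; D_2, D_1; \<dots>; D_{m-1}, \<dots>, D_1\<close> (the longest one) absorbs every \<open>D_j\<close> on both sides and
  therefore computes \<open>D a\<close>. Its \<open>k\<close>-th block inserts row \<open>k + 1\<close> into the condensation of the
  rows below, and a single \<open>D_j\<close> in it is one application of the octahedron recurrence. This is the
  statement about \<open>D\<close>. The recurrence is invariant under exchanging the first and third coordinates,
  and on the face \<open>x \<le> y \<le> z\<close> the solution is \<open>f_a (x, z)\<close>, which mirrors the boundary condition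
  on \<open>y = z\<close>. So transposing \<open>a\<close> amounts to exchanging \<open>x\<close> and \<open>z\<close>, which gives the statement
  about \<open>L\<close>.
\<close>

section \<open>Longest words in 0-Hecke actions\<close>

text \<open>Actions of the 0-Hecke monoid of the symmetric group on \<open>m\<close> letters. The
  relations are asked only on a carrier \<open>X\<close>, since idempotence and braiding of
  \<open>D_op\<close> are proved for nonnegative arrays.\<close>

locale zero_hecke_action =
  fixes m :: nat and X :: "'x set" and T :: "nat \<Rightarrow> 'x \<Rightarrow> 'x"
  assumes closed: "j \<in> {1..<m} \<Longrightarrow> x \<in> X \<Longrightarrow> T j x \<in> X"
    and idem: "j \<in> {1..<m} \<Longrightarrow> x \<in> X \<Longrightarrow> T j (T j x) = T j x"
    and far: "i \<in> {1..<m} \<Longrightarrow> j \<in> {1..<m} \<Longrightarrow> i + 2 \<le> j \<Longrightarrow> x \<in> X \<Longrightarrow> T i (T j x) = T j (T i x)"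
    and braid: "1 \<le> j \<Longrightarrow> Suc j < m \<Longrightarrow> x \<in> X \<Longrightarrow>
      T j (T (Suc j) (T j x)) = T (Suc j) (T j (T (Suc j) x))"
begin

fun sweep :: "nat \<Rightarrow> 'x \<Rightarrow> 'x" where
  "sweep 0 x = x"
| "sweep (Suc k) x = sweep k (T (Suc k) x)"

fun longest :: "nat \<Rightarrow> 'x \<Rightarrow> 'x" where
  "longest 0 x = x"
| "longest (Suc k) x = sweep k (longest k x)"

lemma sweep_closed: "k < m \<Longrightarrow> x \<in> X \<Longrightarrow> sweep k x \<in> X"
  by (induction k arbitrary: x) (auto simp: closed)

lemma longest_closed: "k \<le> m \<Longrightarrow> x \<in> X \<Longrightarrow> longest k x \<in> X"
  by (induction k) (auto simp: sweep_closed)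

lemma sweep_far: "k + 2 \<le> j \<Longrightarrow> j < m \<Longrightarrow> x \<in> X \<Longrightarrow> T j (sweep k x) = sweep k (T j x)"
  by (induction k arbitrary: x) (auto simp: closed far)

lemma longest_far: "k + 1 \<le> j \<Longrightarrow> j < m \<Longrightarrow> x \<in> X \<Longrightarrow> T j (longest k x) = longest k (T j x)"
  by (induction k arbitrary: x) (auto simp: sweep_far longest_closed)

text \<open>\<open>T j\<close> commutes past all factors of index below \<open>j - 1\<close>. One
  braid move then leaves an innermost \<open>T (j - 1)\<close>, which commutes with the factors of
  index above \<open>j\<close>.\<close>

lemma sweep_shift:
  assumes "2 \<le> j" "j \<le> k" "k < m" "x \<in> X"
  shows "T j (sweep k x) = sweep k (T (j - 1) x)"
  using assms
proof (induction k arbitrary: x)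
  case 0
  then show ?case by simp
next
  case (Suc k)
  then have Tx: "T (Suc k) x \<in> X" by (simp add: closed)
  show ?case
  proof (cases "j = Suc k")
    case False
    then have "T (j - 1) (T (Suc k) x) = T (Suc k) (T (j - 1) x)"
      using Suc.prems by (intro far) auto
    then show ?thesis
      using Suc Tx False by simp
  next
    case True
    then obtain l where l: "k = Suc l"
      using Suc.prems by (cases k) auto
    have "T (Suc k) (sweep k (T (Suc k) x)) = sweep l (T (Suc k) (T k (T (Suc k) x)))"
      using l Suc.prems Tx by (simp add: sweep_far closed)
    also have "\<dots> = sweep l (T k (T (Suc k) (T k x)))"
      using Suc.prems l by (simp add: braid)
    finally show ?thesis
      using True l by simp
  qed
qed

lemma sweep_absorb_one: "1 \<le> k \<Longrightarrow> k < m \<Longrightarrow> x \<in> X \<Longrightarrow> T 1 (sweep k x) = sweep k x"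
proof (induction k arbitrary: x)
  case (Suc k)
  then show ?case
    by (cases k) (auto simp: closed idem)
qed simp

text \<open>The outermost factor of the last sweep absorbs \<open>T 1\<close>. For larger
  \<open>j\<close> that sweep lets \<open>T j\<close> through as \<open>T (j - 1)\<close>, which the
  shorter word absorbs by induction.\<close>

lemma longest_absorb_left:
  "j \<in> {1..<k} \<Longrightarrow> k \<le> m \<Longrightarrow> x \<in> X \<Longrightarrow> T j (longest k x) = longest k x"
proof (induction k arbitrary: j)
  case (Suc k)
  show ?case
  proof (cases "j = 1")
    case True
    then show ?thesis
      using Suc.prems by (auto simp: sweep_absorb_one[simplified] longest_closed)
  next
    case False
    then have "T (j - 1) (longest k x) = longest k x"
      using Suc.prems False by (intro Suc.IH) auto
    then show ?thesis
      using Suc.prems False by (simp add: sweep_shift longest_closed)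
  qed
qed simp

text \<open>The newest generator is absorbed from the right: a braid move on the three innermost
  factors creates an outer factor that the induction hypothesis deletes.\<close>

lemma sweep_sweep_absorb:
  "Suc k < m \<Longrightarrow> x \<in> X \<Longrightarrow> sweep (Suc k) (sweep k (T (Suc k) x)) = sweep (Suc k) (sweep k x)"
proof (induction k arbitrary: x)
  case 0
  then show ?case by (simp add: idem)
next
  case (Suc k)
  let ?T = "T (Suc k)" and ?U = "T (Suc (Suc k))"
  have mem: "x \<in> X" "?T x \<in> X" "?U x \<in> X" "?T (?U x) \<in> X" "?U (?T x) \<in> X"
    using Suc.prems by (auto simp: closed)
  have "sweep (Suc (Suc k)) (sweep (Suc k) (?U x)) = sweep (Suc k) (sweep k (?U (?T (?U x))))"
    using Suc.prems mem by (simp add: sweep_far)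
  also have "\<dots> = sweep (Suc k) (sweep k (?T (?U (?T x))))"
    using Suc.prems by (simp add: braid)
  also have "\<dots> = sweep (Suc k) (sweep k (?U (?T x)))"
    using Suc.prems mem by (intro Suc.IH) auto
  also have "\<dots> = sweep (Suc (Suc k)) (sweep (Suc k) x)"
    using Suc.prems mem by (simp add: sweep_far)
  finally show ?case .
qed

lemma longest_absorb_right:
  "j \<in> {1..<k} \<Longrightarrow> k \<le> m \<Longrightarrow> x \<in> X \<Longrightarrow> longest k (T j x) = longest k x"
proof (induction k)
  case (Suc k)
  show ?case
  proof (cases "j = k")
    case False
    then show ?thesis using Suc by auto
  next
    case True
    then obtain l where l: "k = Suc l"
      using Suc.prems by (cases k) auto
    \<comment> \<open>The word \<open>longest l\<close> uses only indices below \<open>l\<close>, so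
      \<open>T k\<close> passes it and meets the last two sweeps.\<close>
    then have "longest l (T k x) = T k (longest l x)"
      using Suc.prems longest_far by auto
    then show ?thesis
      using sweep_sweep_absorb[of l "longest l x"] l True Suc.prems
      by (simp add: longest_closed)
  qed
qed simp

end

section \<open>The operators as queues\<close>

text \<open>
  Scanning columns from left to right, \<open>backlog a j i\<close> is the mass of row \<open>j\<close> in columns \<open>1, \<dots>, i\<close>
  that has not yet blocked mass of row \<open>j + 1\<close> from coming down.
\<close>

definition backlog :: "arr \<Rightarrow> nat \<Rightarrow> nat \<Rightarrow> real" where
  "backlog a j i = moved a j i - (\<Sum>i'=1..i. a i' (Suc j)) + (\<Sum>i'=1..i. a i' j)"

lemma is_array_nonneg: "is_array n m a \<Longrightarrow> 0 \<le> a i j"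
  unfolding is_array_def by (metis order_refl)

lemma is_array_outside:
  "is_array n m a \<Longrightarrow> \<not> (1 \<le> i \<and> i \<le> n \<and> 1 \<le> j \<and> j \<le> m) \<Longrightarrow> a i j = 0"
  by (simp add: is_array_def)

lemma excess_Suc: "excess a j (Suc i) = (\<Sum>i'=1..Suc i. a i' (Suc j)) - (\<Sum>i'=1..i. a i' j)"
  by (simp add: excess_def atLeastLessThanSuc_atLeastAtMost)

text \<open>The default value 0 at column 0 fits the running maximum because the first excess is an
  entry of the array, hence nonnegative.\<close>

lemma moved_Suc:
  assumes "is_array n m a"
  shows "moved a j (Suc i) = max (moved a j i) (excess a j (Suc i))"
proof (cases i)
  case 0
  then show ?thesis
    using is_array_nonneg[OF assms] by (simp add: moved_def excess_def)
next
  case (Suc k)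
  have "{1..Suc i} = insert (Suc i) {1..i}" by auto
  then have "Max (excess a j ` {1..Suc i}) = max (excess a j (Suc i)) (Max (excess a j ` {1..i}))"
    using Suc by (simp del: atLeastAtMost_insertL)
  then show ?thesis
    using Suc by (simp add: moved_def max.commute)
qed

lemma backlog_0 [simp]: "backlog a j 0 = 0"
  by (simp add: backlog_def moved_def)

text \<open>Service precedes arrival: mass of row \<open>j\<close> blocks only in later columns, as
  the strict bound in \<open>excess\<close> demands.\<close>

lemma backlog_Suc:
  assumes "is_array n m a"
  shows "backlog a j (Suc i) =
    backlog a j i - min (a (Suc i) (Suc j)) (backlog a j i) + a (Suc i) j"
  unfolding backlog_def moved_Suc[OF assms] excess_Suc by (simp add: max_def min_def)

lemma backlog_nonneg: "is_array n m a \<Longrightarrow> 0 \<le> backlog a j i"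
proof (induction i)
  case (Suc i)
  then show ?case
    using is_array_nonneg[of n m a "Suc i" j] by (simp add: backlog_Suc min_def)
qed simp

lemma D_op_upper:
  assumes "is_array n m a"
  shows "D_op n j a (Suc i) (Suc j) = min (a (Suc i) (Suc j)) (backlog a j i)"
proof (cases "Suc i \<le> n")
  case True
  then show ?thesis
    unfolding D_op_def backlog_def using moved_Suc[OF assms, of j i] excess_Suc[of a j i]
    by (simp add: max_def min_def)
next
  case False
  then have "a (Suc i) (Suc j) = 0"
    using is_array_outside[OF assms] by simp
  then show ?thesis
    using False backlog_nonneg[OF assms] by (simp add: D_op_def)
qed

lemma D_op_lower:
  assumes "is_array n m a"
  shows "D_op n j a (Suc i) j =
    a (Suc i) j + a (Suc i) (Suc j) - min (a (Suc i) (Suc j)) (backlog a j i)"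
  using D_op_column_sum[of n j a "Suc i"] D_op_upper[OF assms, of j i] by simp

lemma D_op_0 [simp]: "D_op n j a 0 r = a 0 r"
  by (simp add: D_op_def)

lemma D_op_other [simp]: "r \<noteq> j \<Longrightarrow> r \<noteq> Suc j \<Longrightarrow> D_op n j a i r = a i r"
  by (simp add: D_op_def)

lemma is_array_D_op:
  assumes a: "is_array n m a" and j: "j \<in> {1..<m}"
  shows "is_array n m (D_op n j a)"
proof -
  have "0 \<le> D_op n j a i r" for i r
  proof (cases i)
    case 0
    then show ?thesis using is_array_nonneg[OF a] by simp
  next
    case (Suc k)
    then show ?thesis
      using is_array_nonneg[OF a, of i j] is_array_nonneg[OF a, of i "Suc j"]
        is_array_nonneg[OF a, of i r] backlog_nonneg[OF a, of j k]
        D_op_upper[OF a, of j k] D_op_lower[OF a, of j k]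
      by (cases "r = j \<or> r = Suc j") auto
  qed
  moreover have "D_op n j a i r = 0" if "\<not> (i \<in> {1..n} \<and> r \<in> {1..m})" for i r
    using that j is_array_outside[OF a, of i r] by (auto simp: D_op_def)
  ultimately show ?thesis by (simp add: is_array_def)
qed

lemma D_op_idem:
  assumes a: "is_array n m a" and j: "j \<in> {1..<m}"
  shows "D_op n j (D_op n j a) = D_op n j a"
proof -
  let ?b = "D_op n j a"
  have b: "is_array n m ?b" by (rule is_array_D_op[OF a j])
  \<comment> \<open>A pass adds mass to row \<open>j\<close> and removes it from row
    \<open>j + 1\<close>, so the backlog can only grow; what stayed up once is blocked
    again.\<close>
  have le: "backlog a j i \<le> backlog ?b j i" for i
  proof (induction i)
    case (Suc i)
    then show ?case
      using is_array_nonneg[OF a, of "Suc i" "Suc j"]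
      by (simp add: backlog_Suc[OF a] backlog_Suc[OF b] D_op_upper[OF a] D_op_lower[OF a])
  qed simp
  have "D_op n j ?b i r = ?b i r" for i r
  proof (cases i)
    case (Suc k)
    then show ?thesis
      using le[of k] D_op_upper[OF b, of j k] D_op_lower[OF b, of j k] D_op_upper[OF a, of j k]
      by (cases "r = j \<or> r = Suc j") auto
  qed simp
  then show ?thesis by blast
qed

section \<open>Commutation and braid relations\<close>

lemma moved_cong: "(\<And>i. a i j = b i j) \<Longrightarrow> (\<And>i. a i (Suc j) = b i (Suc j)) \<Longrightarrow> moved a j i = moved b j i"
  by (simp add: moved_def excess_def[abs_def])

lemma D_op_far:
  assumes "i + 2 \<le> j"
  shows "D_op n i (D_op n j a) = D_op n j (D_op n i a)"
proof -
  have "moved (D_op n j a) i = moved a i" "moved (D_op n i a) j = moved a j"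
    using assms by (intro ext moved_cong; simp)+
  then show ?thesis
    using assms by (auto simp: D_op_def[of n i] D_op_def[of n j] fun_eq_iff)
qed

text \<open>
  One column \<open>(a, b, c)\<close> passes through the two words of the braid relation. The relation between
  the backlogs \<open>(s, t, u)\<close> and \<open>(s', t', u')\<close> is the piecewise linear form of Lusztig's transition map
  \<open>(s, t, u) \<mapsto> (t u / (s + u), s + u, s t / (s + u))\<close>, with \<open>+\<close> read as \<open>min\<close> and products as sums.
\<close>

lemma lusztig_step:
  fixes a b c s t u :: real
  assumes "0 \<le> a" "0 \<le> b" "0 \<le> c" "0 \<le> s" "0 \<le> t" "0 \<le> u"
    and "b1 = min b s" "c1 = min c t" "b2 = b1 + c - c1" "b3 = min b2 u"
    and "s' = t + u - min s u" "t' = min s u" "u' = s + t - min s u"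
    and "c1' = min c s'" "b2' = min (b + c - c1') t'" "c2' = min c1' u'"
  defines "s_next \<equiv> s - b1 + a" and "t_next \<equiv> t - c1 + b1" and "u_next \<equiv> u - b3 + (a + b - b1)"
  shows "c2' = c1"
    and "b2' + c1' - c2' = b3"
    and "s' - c1' + b = t_next + u_next - min s_next u_next"
    and "t' - b2' + a = min s_next u_next"
    and "u' - c2' + b2' = s_next + t_next - min s_next u_next"
  using assms(1-16) unfolding s_next_def t_next_def u_next_def
  by - (simp add: min_def split: if_splits)+

text \<open>Both words run in parallel over the columns. The invariant \<open>lusztig\<close> links
  their backlogs; it starts from all backlogs being 0.\<close>

lemma D_op_braid:
  assumes a: "is_array n m a" and j: "1 \<le> j" "Suc j < m"
  shows "D_op n j (D_op n (Suc j) (D_op n j a)) = D_op n (Suc j) (D_op n j (D_op n (Suc j) a))"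
proof -
  define b where "b = D_op n j a"
  define c where "c = D_op n (Suc j) b"
  define b' where "b' = D_op n (Suc j) a"
  define c' where "c' = D_op n j b'"
  have arr: "is_array n m b" "is_array n m c" "is_array n m b'" "is_array n m c'"
    using a j by (auto simp: b_def c_def b'_def c'_def is_array_D_op)
  define s where "s = backlog a j"
  define t where "t = backlog b (Suc j)"
  define u where "u = backlog c j"
  define s' where "s' = backlog a (Suc j)"
  define t' where "t' = backlog b' j"
  define u' where "u' = backlog c' (Suc j)"
  note states = s_def t_def u_def s'_def t'_def u'_def
  have entries:
    "b (Suc i) j = a (Suc i) j + a (Suc i) (Suc j) - b (Suc i) (Suc j)"
    "b (Suc i) (Suc j) = min (a (Suc i) (Suc j)) (s i)"
    "b (Suc i) (Suc (Suc j)) = a (Suc i) (Suc (Suc j))"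
    "c (Suc i) j = b (Suc i) j"
    "c (Suc i) (Suc j) = b (Suc i) (Suc j) + b (Suc i) (Suc (Suc j)) - c (Suc i) (Suc (Suc j))"
    "c (Suc i) (Suc (Suc j)) = min (b (Suc i) (Suc (Suc j))) (t i)"
    "b' (Suc i) j = a (Suc i) j"
    "b' (Suc i) (Suc j) = a (Suc i) (Suc j) + a (Suc i) (Suc (Suc j)) - b' (Suc i) (Suc (Suc j))"
    "b' (Suc i) (Suc (Suc j)) = min (a (Suc i) (Suc (Suc j))) (s' i)"
    "c' (Suc i) j = b' (Suc i) j + b' (Suc i) (Suc j) - c' (Suc i) (Suc j)"
    "c' (Suc i) (Suc j) = min (b' (Suc i) (Suc j)) (t' i)"
    "c' (Suc i) (Suc (Suc j)) = b' (Suc i) (Suc (Suc j))" for i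
    using D_op_upper[OF a] D_op_lower[OF a] D_op_upper[OF arr(1)] D_op_lower[OF arr(1)]
      D_op_upper[OF arr(3)] D_op_lower[OF arr(3)]
    by (simp_all add: b_def[symmetric] c_def[symmetric] b'_def[symmetric] c'_def[symmetric] states)
       (simp_all add: b_def c_def b'_def c'_def)
  have steps:
    "s (Suc i) = s i - min (a (Suc i) (Suc j)) (s i) + a (Suc i) j"
    "t (Suc i) = t i - min (b (Suc i) (Suc (Suc j))) (t i) + b (Suc i) (Suc j)"
    "u (Suc i) = u i - min (c (Suc i) (Suc j)) (u i) + c (Suc i) j"
    "s' (Suc i) = s' i - min (a (Suc i) (Suc (Suc j))) (s' i) + a (Suc i) (Suc j)"
    "t' (Suc i) = t' i - min (b' (Suc i) (Suc j)) (t' i) + b' (Suc i) j"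
    "u' (Suc i) = u' i - min (c' (Suc i) (Suc (Suc j))) (u' i) + c' (Suc i) (Suc j)" for i
    using a arr by (simp_all add: states backlog_Suc)
  have nonneg: "0 \<le> s i" "0 \<le> t i" "0 \<le> u i" for i
    using a arr by (simp_all add: states backlog_nonneg)
  have nonneg_a: "0 \<le> a i r" for i r
    by (rule is_array_nonneg[OF a])
  have step:
    "min (c' (Suc i) (Suc (Suc j))) (u' i) = c (Suc i) (Suc (Suc j))"
    "c' (Suc i) (Suc j) + c' (Suc i) (Suc (Suc j)) - min (c' (Suc i) (Suc (Suc j))) (u' i) =
      min (c (Suc i) (Suc j)) (u i)"
    "s' (Suc i) = t (Suc i) + u (Suc i) - min (s (Suc i)) (u (Suc i)) \<and>
      t' (Suc i) = min (s (Suc i)) (u (Suc i)) \<and>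
      u' (Suc i) = s (Suc i) + t (Suc i) - min (s (Suc i)) (u (Suc i))"
    if "s' i = t i + u i - min (s i) (u i) \<and> t' i = min (s i) (u i) \<and>
      u' i = s i + t i - min (s i) (u i)" for i
  proof -
    let ?a = "a (Suc i)" and ?b = "b (Suc i)" and ?c = "c (Suc i)"
      and ?b' = "b' (Suc i)" and ?c' = "c' (Suc i)" and ?k = "Suc j" and ?l = "Suc (Suc j)"
    \<comment> \<open>The reflexive equations here and in \<open>second\<close> instantiate
      \<open>b3\<close> and \<open>c2'\<close> in \<open>lusztig_step\<close>.\<close>
    have first: "?b ?k = min (?a ?k) (s i)" "?c ?l = min (?a ?l) (t i)"
        "?c ?k = ?b ?k + ?a ?l - ?c ?l" "min (?c ?k) (u i) = min (?c ?k) (u i)"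
      by (simp_all only: entries)
    have states: "s' i = t i + u i - min (s i) (u i)" "t' i = min (s i) (u i)"
        "u' i = s i + t i - min (s i) (u i)"
      using that by blast+
    have second: "?c' ?l = min (?a ?l) (s' i)" "?c' ?k = min (?a ?k + ?a ?l - ?c' ?l) (t' i)"
        "min (?c' ?l) (u' i) = min (?c' ?l) (u' i)"
      by (simp_all only: entries)
    note column = lusztig_step[OF nonneg_a[of "Suc i" j] nonneg_a nonneg_a nonneg
      first states second]
    show "min (?c' ?l) (u' i) = ?c ?l"
      and "?c' ?k + ?c' ?l - min (?c' ?l) (u' i) = min (?c ?k) (u i)"
      by (fact column)+
    have "s (Suc i) = s i - ?b ?k + ?a j" "t (Suc i) = t i - ?c ?l + ?b ?k"
      "u (Suc i) = u i - min (?c ?k) (u i) + (?a j + ?a ?k - ?b ?k)"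
      "s' (Suc i) = s' i - ?c' ?l + ?a ?k" "t' (Suc i) = t' i - ?c' ?k + ?a j"
      "u' (Suc i) = u' i - min (?c' ?l) (u' i) + ?c' ?k"
      unfolding steps by (simp_all only: entries)
    then show "s' (Suc i) = t (Suc i) + u (Suc i) - min (s (Suc i)) (u (Suc i)) \<and>
        t' (Suc i) = min (s (Suc i)) (u (Suc i)) \<and>
        u' (Suc i) = s (Suc i) + t (Suc i) - min (s (Suc i)) (u (Suc i))"
      using column(3-5) by argo
  qed
  have lusztig: "s' i = t i + u i - min (s i) (u i) \<and> t' i = min (s i) (u i) \<and>
      u' i = s i + t i - min (s i) (u i)" for i
    by (induction i) (simp add: states, rule step(3))
  have "D_op n j c i r = D_op n (Suc j) c' i r" for i r
  proof (cases i)
    case 0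
    then show ?thesis by (simp add: b_def c_def b'_def c'_def)
  next
    case (Suc k)
    have "D_op n j c (Suc k) j = c (Suc k) j + c (Suc k) (Suc j) - min (c (Suc k) (Suc j)) (u k)"
      "D_op n j c (Suc k) (Suc j) = min (c (Suc k) (Suc j)) (u k)"
      "D_op n j c (Suc k) (Suc (Suc j)) = c (Suc k) (Suc (Suc j))"
      "D_op n (Suc j) c' (Suc k) j = c' (Suc k) j"
      "D_op n (Suc j) c' (Suc k) (Suc j) =
        c' (Suc k) (Suc j) + c' (Suc k) (Suc (Suc j)) - min (c' (Suc k) (Suc (Suc j))) (u' k)"
      "D_op n (Suc j) c' (Suc k) (Suc (Suc j)) = min (c' (Suc k) (Suc (Suc j))) (u' k)"
      using D_op_upper[OF arr(2)] D_op_lower[OF arr(2)] D_op_upper[OF arr(4)] D_op_lower[OF arr(4)]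
      by (simp_all add: states)
    moreover note step(1,2)[OF lusztig, of k]
    \<comment> \<open>Two entries agree by \<open>step\<close>; conservation of column mass forces
      the third, in row \<open>j\<close>.\<close>
    moreover have "c (Suc k) j + c (Suc k) (Suc j) + c (Suc k) (Suc (Suc j)) =
        c' (Suc k) j + c' (Suc k) (Suc j) + c' (Suc k) (Suc (Suc j))"
      by (simp add: entries)
    ultimately have
      "D_op n j c (Suc k) j = D_op n (Suc j) c' (Suc k) j"
      "D_op n j c (Suc k) (Suc j) = D_op n (Suc j) c' (Suc k) (Suc j)"
      "D_op n j c (Suc k) (Suc (Suc j)) = D_op n (Suc j) c' (Suc k) (Suc (Suc j))"
      by linarith+
    moreover have "D_op n j c (Suc k) r = D_op n (Suc j) c' (Suc k) r"
      if "r \<notin> {j, Suc j, Suc (Suc j)}"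
      using that by (simp add: b_def c_def b'_def c'_def)
    ultimately show ?thesis
      using Suc by blast
  qed
  then show ?thesis
    unfolding b_def c_def b'_def c'_def by blast
qed

section \<open>Condensation along the longest word\<close>

interpretation D: zero_hecke_action m "Collect (is_array n m)" "D_op n" for n m
  by unfold_locales (auto intro: is_array_D_op D_op_idem D_op_far D_op_braid)

lemma D_reach_sweep:
  "D_reach n m a b \<Longrightarrow> k < m \<Longrightarrow> D_reach n m a (D.sweep n k b)"
  by (induction k arbitrary: b) (simp_all add: D_reach.step)

lemma D_reach_longest: "k \<le> m \<Longrightarrow> D_reach n m a (D.longest n k a)"
  by (induction k) (auto intro: D_reach.refl D_reach_sweep)

lemma D_reach_imp_longest_eq:
  "D_reach n m a b \<Longrightarrow> is_array n m a \<Longrightarrow> is_array n m b \<and> D.longest n m b = D.longest n m a"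
proof (induction rule: D_reach.induct)
  case (step b j)
  then show ?case
    using D.longest_absorb_right[of j m m b n] by (simp add: is_array_D_op)
qed simp

lemma D_tight_imp_longest_eq:
  assumes "D_tight n m b"
  shows "D.longest n m b = b"
proof -
  have "D.sweep n k b = b" if "k < m" for k
    using that assms by (induction k) (auto simp: D_tight_def)
  then have "D.longest n k b = b" if "k \<le> m" for k
    using that by (induction k) auto
  then show ?thesis by blast
qed

text \<open>Left absorption makes the result tight. Right absorption makes \<open>D.longest\<close>
  constant along \<open>D_reach\<close>, and it fixes tight arrays, whence uniqueness.\<close>

lemma D_condense_eq_longest:
  assumes "is_array n m a"
  shows "D_condense n m a = D.longest n m a"
  unfolding D_condense_def
proof (rule the_equality)
  show "D_reach n m a (D.longest n m a) \<and> D_tight n m (D.longest n m a)"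
    using assms D.longest_absorb_left[of _ m m a n] by (auto simp: D_tight_def D_reach_longest)
qed (use assms D_reach_imp_longest_eq D_tight_imp_longest_eq in metis)

section \<open>Sweeps as layers of the octahedron recurrence\<close>

lemma cumul_0 [simp]: "cumul a 0 j = 0" "cumul a i 0 = 0"
  by (simp_all add: cumul_def)

lemma cumul_Suc: "cumul a i (Suc j) = cumul a i j + (\<Sum>i'=1..i. a i' (Suc j))"
  by (simp add: cumul_def sum.distrib)

lemma cumul_D_op:
  assumes "i \<le> n" "1 \<le> j"
  shows "cumul (D_op n j a) i r = cumul a i r + (if r = j then moved a j i else 0)"
proof -
  have lower: "(\<Sum>i'=1..i. D_op n j a i' j) = (\<Sum>i'=1..i. a i' j) + moved a j i"
    by (rule D_op_prefix_sum[OF assms(1)])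
  have "(\<Sum>i'=1..i. D_op n j a i' j + D_op n j a i' (Suc j)) = (\<Sum>i'=1..i. a i' j + a i' (Suc j))"
    using D_op_column_sum[of n j a] by simp
  then have upper: "(\<Sum>i'=1..i. D_op n j a i' (Suc j)) = (\<Sum>i'=1..i. a i' (Suc j)) - moved a j i"
    using lower by (simp add: sum.distrib)
  show ?thesis
  proof (induction r)
    case 0
    then show ?case using assms by simp
  next
    case (Suc r)
    consider "Suc r = j" | "r = j" | "Suc r \<noteq> j" "r \<noteq> j" by blast
    then show ?case
      using Suc lower upper by cases (auto simp: cumul_Suc)
  qed
qed

text \<open>In this form the running maximum \<open>moved\<close> matches the maximum in the
  recurrence.\<close>

lemma excess_cumul:
  "excess a (Suc j) (Suc i) =
    cumul a (Suc i) (Suc (Suc j)) - cumul a (Suc i) (Suc j) - cumul a i (Suc j) + cumul a i j"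
  unfolding excess_Suc cumul_Suc[of a _ "Suc j"] cumul_Suc[of a i j] by simp

lemma oct_rec_Suc:
  assumes "y < z"
  shows "oct_rec a (Suc x) (Suc y) (Suc z) =
    max (oct_rec a (Suc x) (Suc y) z + oct_rec a x (Suc y) (Suc z))
        (oct_rec a x y z + oct_rec a (Suc x) (Suc (Suc y)) (Suc z)) - oct_rec a x (Suc y) z"
  using assms by (subst oct_rec.simps) simp

text \<open>A sweep carries layer \<open>z = k\<close> to layer \<open>z = k + 1\<close> from the
  top row downwards: rows above \<open>q\<close> are already on the new layer, the others still on
  the old one.\<close>

lemma cumul_sweep:
  assumes "is_array n m c" "k < m" "q \<le> k"
    and "\<And>i j. i \<le> n \<Longrightarrow> j \<le> q \<Longrightarrow> cumul c i j = oct_rec a i j k"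
    and "\<And>i j. i \<le> n \<Longrightarrow> q < j \<Longrightarrow> j \<le> Suc k \<Longrightarrow> cumul c i j = oct_rec a i j (Suc k)"
    and "i \<le> n" "j \<le> Suc k"
  shows "cumul (D.sweep n q c) i j = oct_rec a i j (Suc k)"
  using assms
proof (induction q arbitrary: c i j)
  case 0
  then show ?case by (cases j) (auto simp: oct_rec_zero)
next
  case (Suc q)
  note c = Suc.prems(1) and below = Suc.prems(4) and above = Suc.prems(5)
  have row: "cumul c i (Suc q) + moved c (Suc q) i = oct_rec a i (Suc q) (Suc k)" if "i \<le> n" for i
    using that
  proof (induction i)
    case 0
    then show ?case by (simp add: moved_def oct_rec_zero)
  next
    case (Suc i)
    have vals: "cumul c i q = oct_rec a i q k" "cumul c i (Suc q) = oct_rec a i (Suc q) k"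
      "cumul c (Suc i) (Suc q) = oct_rec a (Suc i) (Suc q) k"
      "cumul c (Suc i) (Suc (Suc q)) = oct_rec a (Suc i) (Suc (Suc q)) (Suc k)"
      using \<open>Suc i \<le> n\<close> \<open>Suc q \<le> k\<close> by (auto intro!: below above)
    have "oct_rec a (Suc i) (Suc q) (Suc k) =
        max (oct_rec a (Suc i) (Suc q) k + oct_rec a i (Suc q) (Suc k))
            (oct_rec a i q k + oct_rec a (Suc i) (Suc (Suc q)) (Suc k)) - oct_rec a i (Suc q) k"
      using \<open>Suc q \<le> k\<close> by (intro oct_rec_Suc) simp
    moreover have "moved c (Suc q) (Suc i) = max (moved c (Suc q) i) (excess c (Suc q) (Suc i))"
      by (rule moved_Suc[OF c])
    ultimately show ?case
      using Suc vals unfolding excess_cumul by (simp add: max_def)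
  qed
  have "cumul (D.sweep n q (D_op n (Suc q) c)) i j = oct_rec a i j (Suc k)"
  proof (rule Suc.IH)
    show "is_array n m (D_op n (Suc q) c)"
      using Suc.prems by (intro is_array_D_op) auto
    show "cumul (D_op n (Suc q) c) i j = oct_rec a i j k" if "i \<le> n" "j \<le> q" for i j
      using that below by (simp add: cumul_D_op)
    show "cumul (D_op n (Suc q) c) i j = oct_rec a i j (Suc k)"
      if "i \<le> n" "q < j" "j \<le> Suc k" for i j
      using that row above by (cases "j = Suc q") (auto simp: cumul_D_op)
  qed (use Suc.prems in auto)
  then show ?case by simp
qed

lemma cumul_sweep_above: "k < j \<Longrightarrow> i \<le> n \<Longrightarrow> cumul (D.sweep n k a) i j = cumul a i j"
  by (induction k arbitrary: a) (auto simp: cumul_D_op)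

lemma cumul_longest_above: "k \<le> j \<Longrightarrow> i \<le> n \<Longrightarrow> cumul (D.longest n k a) i j = cumul a i j"
  by (induction k) (auto simp: cumul_sweep_above)

lemma cumul_longest:
  assumes "is_array n m a" "k \<le> m" "i \<le> n" "j \<le> k"
  shows "cumul (D.longest n k a) i j = oct_rec a i j k"
  using assms
proof (induction k arbitrary: i j)
  case 0
  then show ?case by (simp add: oct_rec_zero)
next
  case (Suc k)
  have "cumul (D.sweep n k (D.longest n k a)) i j = oct_rec a i j (Suc k)"
  proof (rule cumul_sweep)
    show "is_array n m (D.longest n k a)"
      using D.longest_closed[of k m a n] Suc.prems by simp
    \<comment> \<open>The first \<open>k\<close> blocks do not reach row \<open>Suc k\<close>, so
      its cumulative sums are still the boundary values on \<open>y = z\<close>.\<close>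
    show "cumul (D.longest n k a) i j = oct_rec a i j (Suc k)"
      if "i \<le> n" "k < j" "j \<le> Suc k" for i j
    proof -
      have j: "j = Suc k" using that by simp
      show ?thesis
        unfolding j using \<open>i \<le> n\<close> by (simp add: cumul_longest_above oct_rec_diag)
    qed
  qed (use Suc in auto)
  then show ?case by simp
qed

lemma cumul_D_condense:
  "is_array n m a \<Longrightarrow> i \<le> n \<Longrightarrow> j \<le> m \<Longrightarrow> cumul (D_condense n m a) i j = oct_rec a i j m"
  by (simp add: D_condense_eq_longest cumul_longest)

section \<open>Transposition\<close>

lemma cumul_transpose: "cumul (arr_transpose a) j i = cumul a i j"
  unfolding cumul_def arr_transpose_def by (rule sum.swap)

lemma is_array_transpose: "is_array n m a \<Longrightarrow> is_array m n (arr_transpose a)"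
  by (auto simp: is_array_def arr_transpose_def)

lemma cumul_corner:
  "cumul a (Suc x) (Suc z) = cumul a (Suc x) z + cumul a x (Suc z) - cumul a x z + a (Suc x) (Suc z)"
  by (simp add: cumul_Suc)

lemma oct_rec_flat:
  assumes a: "is_array n m a" and "x \<le> y" "y \<le> z"
  shows "oct_rec a x y z = cumul a x z"
  using assms(2,3)
\<comment> \<open>All points on the right of the recurrence have smaller \<open>x + z - y\<close>,
  even \<open>(x, y + 1, z)\<close>.\<close>
proof (induction "x + z - y" arbitrary: x y z rule: less_induct)
  case less
  show ?case
  proof (cases "x = 0 \<or> y = z")
    case True
    then show ?thesis by (auto simp: oct_rec_zero oct_rec_diag)
  next
    case False
    then obtain x' y' z' where [simp]: "x = Suc x'" "y = Suc y'" "z = Suc z'"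
      using less.prems by (cases x; cases y; cases z) auto
    have "oct_rec a x y z' = cumul a x z'" "oct_rec a x' y z = cumul a x' z"
      "oct_rec a x' y' z' = cumul a x' z'" "oct_rec a x (Suc y) z = cumul a x z"
      "oct_rec a x' y z' = cumul a x' z'"
      using less.prems False by (intro less.hyps; simp)+
    \<comment> \<open>By \<open>cumul_corner\<close> and nonnegativity of \<open>a x z\<close>, the
      second branch of the maximum wins.\<close>
    then show ?thesis
      using oct_rec_Suc[of y' z' a x'] cumul_corner[of a x' z'] is_array_nonneg[OF a, of x z]
        less.prems False by simp
  qed
qed

lemma oct_rec_transpose:
  assumes a: "is_array n m a" and "y \<le> x" "y \<le> z"
  shows "oct_rec (arr_transpose a) z y x = oct_rec a x y z"
  using assms(2,3)
proof (induction "x + z - y" arbitrary: x y z rule: less_induct)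
  case less
  note flat = oct_rec_flat[OF a] oct_rec_flat[OF is_array_transpose[OF a]]
  consider "y = 0" | "y = x" | "y = z" | "0 < y" "y < x" "y < z"
    using less.prems by linarith
  then show ?case
  proof cases
    case 4
    then obtain x' y' z' where [simp]: "x = Suc x'" "y = Suc y'" "z = Suc z'"
      by (cases x; cases y; cases z) auto
    have "oct_rec (arr_transpose a) z' y x = oct_rec a x y z'"
      "oct_rec (arr_transpose a) z y x' = oct_rec a x' y z"
      "oct_rec (arr_transpose a) z' y' x' = oct_rec a x' y' z'"
      "oct_rec (arr_transpose a) z (Suc y) x = oct_rec a x (Suc y) z"
      "oct_rec (arr_transpose a) z' y x' = oct_rec a x' y z'"
      using 4 by (intro less.hyps; simp)+
    then show ?thesis
      using 4 oct_rec_Suc[of y' z' a x'] oct_rec_Suc[of y' x' "arr_transpose a" z']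
      by (simp add: add.commute)
  qed (use less.prems in \<open>auto simp: oct_rec_zero oct_rec_diag flat cumul_transpose\<close>)
qed

lemma cumul_L_condense:
  assumes a: "is_array n m a" and "j \<le> k" "k \<le> m"
  shows "cumul (L_condense n m a) j k = oct_rec a n j k"
proof -
  have L: "cumul (L_condense n m a) j k = cumul (D_condense m n (arr_transpose a)) k j"
    by (simp add: L_condense_def cumul_transpose)
  show ?thesis
  proof (cases "j \<le> n")
    case True
    then show ?thesis
      using assms by (simp add: L cumul_D_condense is_array_transpose oct_rec_transpose)
  next
    case False
    \<comment> \<open>Here \<open>(n, j, k)\<close> lies in the flat region; condensing among the
      \<open>n\<close> columns leaves the totals over all columns unchanged.\<close>
    have "cumul (L_condense n m a) j k = cumul (arr_transpose a) k j"
      using False assms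
      by (simp add: L D_condense_eq_longest[OF is_array_transpose[OF a]] cumul_longest_above)
    also have "\<dots> = cumul a j k"
      by (rule cumul_transpose)
    also have "\<dots> = cumul a n k"
      unfolding cumul_def using False is_array_outside[OF a]
      by (intro sum.mono_neutral_right) auto
    also have "\<dots> = oct_rec a n j k"
      using False assms by (simp add: oct_rec_flat)
    finally show ?thesis .
  qed
qed

theorem theorem2:
  fixes n m :: nat and a :: arr and F :: "int \<times> int \<times> int \<Rightarrow> real"
  assumes "1 \<le> n" and "1 \<le> m"
    and "is_array n m a"
    and "octahedron_solution n m a F"
  shows "(\<forall>i j. i \<le> n \<and> j \<le> m \<longrightarrow>
            F (int i, int j, int m) = cumul (D_condense n m a) i j) \<and>
         (\<forall>j k. j \<le> k \<and> k \<le> m \<longrightarrow>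
            F (int n, int j, int k) = cumul (L_condense n m a) j k)"
  using assms(3) octahedron_solution_eq_oct_rec[OF assms(4)]
  by (simp add: cumul_D_condense cumul_L_condense)

end
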